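(* If $\mathbb{A}$ is a finite category with Möbius inversion then, for all $a, b \in \mathbb{A}$, $$\zeta(a, b) = 0 \implies \mu(a, b) = 0.$$
   Context: For a finite category $\mathbb{A}$, let $R(\mathbb{A})$ be the $\mathbb{Q}$-algebra of functions $\mathrm{ob}\,\mathbb{A} \times \mathrm{ob}\,\mathbb{A} \to \mathbb{Q}$ with pointwise addition and scalar multiplication, multiplication $(\theta\phi)(a,c) = \sum_{b} \theta(a,b)\phi(b,c)$, and unit the Kronecker $\delta$. The zeta function $\zeta \in R(\mathbb{A})$ is $\zeta(a,b) = |\mathbb{A}(a,b)|$. The category $\mathbb{A}$ has Möbius inversion if $\zeta$ is invertible in $R(\mathbb{A})$; its inverse $\mu = \zeta^{-1}$ is the Möbius function of $\mathbb{A}$. *)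

theory Defs
  imports Complex_Main "HOL-Algebra.Module"
begin

record ('o, 'm) category =
  Ob :: "'o set"
  Arr :: "'m set"
  Dom :: "'m \<Rightarrow> 'o"
  Cod :: "'m \<Rightarrow> 'o"
  Ident :: "'o \<Rightarrow> 'm"
  Comp :: "'m \<Rightarrow> 'm \<Rightarrow> 'm"

definition Hom :: "('o, 'm, 'z) category_scheme \<Rightarrow> 'o \<Rightarrow> 'o \<Rightarrow> 'm set" where
  "Hom A a b = {f \<in> Arr A. Dom A f = a \<and> Cod A f = b}"

text \<open>\<open>Comp A g f\<close> is the composite of \<open>g\<close> after \<open>f\<close>; nothing is assumed about
  it when \<open>Dom A g\<close> differs from \<open>Cod A f\<close>.\<close>

locale category =
  fixes A :: "('o, 'm, 'z) category_scheme"
  assumes Dom_in_Ob: "f \<in> Arr A \<Longrightarrow> Dom A f \<in> Ob A"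
    and Cod_in_Ob: "f \<in> Arr A \<Longrightarrow> Cod A f \<in> Ob A"
    and Ident_in_Hom: "a \<in> Ob A \<Longrightarrow> Ident A a \<in> Hom A a a"
    and Comp_in_Hom: "\<lbrakk>f \<in> Hom A a b; g \<in> Hom A b c\<rbrakk> \<Longrightarrow> Comp A g f \<in> Hom A a c"
    and Comp_Ident: "f \<in> Hom A a b \<Longrightarrow> Comp A f (Ident A a) = f"
    and Ident_Comp: "f \<in> Hom A a b \<Longrightarrow> Comp A (Ident A b) f = f"
    and Comp_assoc: "\<lbrakk>f \<in> Hom A a b; g \<in> Hom A b c; h \<in> Hom A c d\<rbrakk>
      \<Longrightarrow> Comp A h (Comp A g f) = Comp A (Comp A h g) f"

locale finite_category = category +
  assumes finite_Ob: "finite (Ob A)"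
    and finite_Arr: "finite (Arr A)"

text \<open>Functions on \<open>Ob A \<times> Ob A\<close> are taken to be extensional (with value
  \<open>undefined\<close> off that set), so that equality in the algebra is equality of functions
  on \<open>Ob A \<times> Ob A\<close>. The record type \<open>module\<close> is a ring together with a scalar
  multiplication; here the scalars are the rationals.\<close>

definition incidence_algebra ::
    "('o, 'm, 'z) category_scheme \<Rightarrow> (rat, 'o \<times> 'o \<Rightarrow> rat) module" where
  "incidence_algebra A = \<lparr>
     carrier = (Ob A \<times> Ob A) \<rightarrow>\<^sub>E UNIV,
     mult = (\<lambda>\<theta> \<phi>. \<lambda>(a, c)\<in>Ob A \<times> Ob A. \<Sum>b\<in>Ob A. \<theta> (a, b) * \<phi> (b, c)),
     one = (\<lambda>(a, b)\<in>Ob A \<times> Ob A. if a = b then 1 else 0),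
     zero = (\<lambda>p\<in>Ob A \<times> Ob A. 0),
     add = (\<lambda>\<theta> \<phi>. \<lambda>p\<in>Ob A \<times> Ob A. \<theta> p + \<phi> p),
     smult = (\<lambda>q \<theta>. \<lambda>p\<in>Ob A \<times> Ob A. q * \<theta> p)\<rparr>"

definition zeta :: "('o, 'm, 'z) category_scheme \<Rightarrow> 'o \<times> 'o \<Rightarrow> rat" where
  "zeta A = (\<lambda>(a, b)\<in>Ob A \<times> Ob A. of_nat (card (Hom A a b)))"

definition has_moebius_inversion :: "('o, 'm, 'z) category_scheme \<Rightarrow> bool" where
  "has_moebius_inversion A \<longleftrightarrow> zeta A \<in> Units (incidence_algebra A)"

definition moebius :: "('o, 'm, 'z) category_scheme \<Rightarrow> 'o \<times> 'o \<Rightarrow> rat" where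
  "moebius A = inv\<^bsub>incidence_algebra A\<^esub> (zeta A)"

lemma (in finite_category) incidence_algebra_ring: "ring (incidence_algebra A)"
proof (rule ringI)
  show "abelian_group (incidence_algebra A)"
  proof (rule abelian_groupI)
    fix x assume "x \<in> carrier (incidence_algebra A)"
    then show "\<exists>y\<in>carrier (incidence_algebra A).
        y \<oplus>\<^bsub>incidence_algebra A\<^esub> x = \<zero>\<^bsub>incidence_algebra A\<^esub>"
      by (intro bexI[of _ "\<lambda>p\<in>Ob A \<times> Ob A. - x p"])
        (auto simp: incidence_algebra_def fun_eq_iff)
  qed (auto simp: incidence_algebra_def fun_eq_iff PiE_def extensional_def algebra_simps)
  show "monoid (incidence_algebra A)"
  proof (rule monoidI)
    fix x y z
    show "x \<otimes>\<^bsub>incidence_algebra A\<^esub> y \<otimes>\<^bsub>incidence_algebra A\<^esub> z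
        = x \<otimes>\<^bsub>incidence_algebra A\<^esub> (y \<otimes>\<^bsub>incidence_algebra A\<^esub> z)"
    proof -
      have "(\<Sum>c\<in>Ob A. (\<Sum>b\<in>Ob A. x (a, b) * y (b, c)) * z (c, d))
          = (\<Sum>b\<in>Ob A. x (a, b) * (\<Sum>c\<in>Ob A. y (b, c) * z (c, d)))" for a d
        unfolding sum_distrib_left sum_distrib_right mult.assoc by (rule sum.swap)
      then show ?thesis
        by (auto simp: incidence_algebra_def fun_eq_iff cong: sum.cong)
    qed
  qed (auto simp: incidence_algebra_def fun_eq_iff PiE_def extensional_def finite_Ob
      if_distrib[of "\<lambda>t. t * _"] if_distrib[of "\<lambda>t. _ * t"] sum.delta sum.delta'
      cong: if_cong)
qed (auto simp: incidence_algebra_def fun_eq_iff sum.distrib algebra_simps)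

lemma zeta_in_carrier: "zeta A \<in> carrier (incidence_algebra A)"
  by (auto simp: zeta_def incidence_algebra_def)

end

theory Submission
  imports Defs "Jordan_Normal_Form.Determinant"
begin

text \<open>
  The relation \<open>\<zeta>(x, y) \<noteq> 0\<close> is a preorder on the objects: identities make it reflexive
  and composition makes it transitive. Fix an object \<open>b\<close> and let \<open>D\<close> be its down-set,
  the set of objects with an arrow to \<open>b\<close>. Transitivity says that no object outside \<open>D\<close> has
  an arrow into \<open>D\<close>, so the matrix \<open>\<zeta>\<close> is block triangular with respect to \<open>D\<close> and its
  complement. The inverse of a block triangular matrix is block triangular with the same
  zero block (\<open>left_inverse_block_triangular\<close>). Since \<open>b\<close> lies in \<open>D\<close>, this gives
  \<open>\<mu>(a, b) = 0\<close> for every \<open>a\<close> outside \<open>D\<close>, that is, whenever \<open>\<zeta>(a, b) = 0\<close>.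

  That the inverse has the same shape is a matter of finite dimension: from \<open>\<mu>\<zeta> = 1\<close> one
  reads off a left inverse of the diagonal block of \<open>\<zeta>\<close> on \<open>D\<close>, and one needs that this
  square block also has a right inverse.
\<close>

text \<open>A one-sided inverse of a square matrix is two-sided. Enumerating the finite index set
  transfers this fact from matrices indexed by an initial segment of the naturals.\<close>

lemma left_inverse_imp_right_inverse_on:
  fixes M N :: "'i \<Rightarrow> 'i \<Rightarrow> 'k::field"
  assumes "finite I"
    and left: "\<And>i j. \<lbrakk>i \<in> I; j \<in> I\<rbrakk> \<Longrightarrow> (\<Sum>k\<in>I. N i k * M k j) = (if i = j then 1 else 0)"
    and "i \<in> I" "j \<in> I"
  shows "(\<Sum>k\<in>I. M i k * N k j) = (if i = j then 1 else 0)"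
proof -
  define n where "n = card I"
  obtain e where e: "bij_betw e {0..<n} I"
    using ex_bij_betw_nat_finite[OF \<open>finite I\<close>] n_def by blast
  define mat_of :: "('i \<Rightarrow> 'i \<Rightarrow> 'k) \<Rightarrow> 'k mat"
    where "mat_of P = mat n n (\<lambda>(r, s). P (e r) (e s))" for P
  have carrier: "mat_of P \<in> carrier_mat n n" for P
    by (simp add: mat_of_def)
  have e_in: "e r \<in> I" if "r < n" for r
    using e that by (auto simp: bij_betw_def)
  have e_eq: "e r = e s \<longleftrightarrow> r = s" if "r < n" "s < n" for r s
    using e that by (auto simp: bij_betw_def inj_on_def)
  have entry: "(mat_of P * mat_of Q) $$ (r, s) = (\<Sum>k\<in>I. P (e r) k * Q k (e s))"
    if "r < n" "s < n" for P Q r s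
    using that sum.reindex_bij_betw[OF e, of "\<lambda>k. P (e r) k * Q k (e s)"]
    by (simp add: mat_of_def scalar_prod_def)
  have "mat_of N * mat_of M = 1\<^sub>m n"
  proof (rule eq_matI)
    fix r s assume "r < dim_row (1\<^sub>m n :: 'k mat)" "s < dim_col (1\<^sub>m n :: 'k mat)"
    then show "(mat_of N * mat_of M) $$ (r, s) = 1\<^sub>m n $$ (r, s)"
      using left e_in e_eq by (simp add: entry)
  qed (simp_all add: mat_of_def)
  then have right: "mat_of M * mat_of N = 1\<^sub>m n"
    by (rule mat_mult_left_right_inverse[OF carrier carrier])
  obtain r s where rs: "r < n" "e r = i" "s < n" "e s = j"
    using e \<open>i \<in> I\<close> \<open>j \<in> I\<close> by (auto simp: bij_betw_def image_iff)
  have "(\<Sum>k\<in>I. M i k * N k j) = (1\<^sub>m n :: 'k mat) $$ (r, s)"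
    using entry[of r s M N] rs right by simp
  then show ?thesis
    using rs e_eq by auto
qed

text \<open>Write \<open>M\<close> and \<open>N\<close> in blocks along \<open>D\<close> and its complement \<open>U\<close>. As the \<open>UD\<close> block of
  \<open>M\<close> is zero, \<open>N M = 1\<close> contains the equations \<open>N\<^sub>D\<^sub>D M\<^sub>D\<^sub>D = 1\<close> and \<open>N\<^sub>U\<^sub>D M\<^sub>D\<^sub>D = 0\<close>. The first
  makes \<open>M\<^sub>D\<^sub>D\<close> invertible, and then the second forces \<open>N\<^sub>U\<^sub>D = 0\<close>.\<close>

lemma left_inverse_block_triangular:
  fixes M N :: "'i \<Rightarrow> 'i \<Rightarrow> 'k::field"
  assumes "finite I" "D \<subseteq> I"
    and left: "\<And>i j. \<lbrakk>i \<in> I; j \<in> I\<rbrakk> \<Longrightarrow> (\<Sum>k\<in>I. N i k * M k j) = (if i = j then 1 else 0)"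
    and zero: "\<And>u d. \<lbrakk>u \<in> I - D; d \<in> D\<rbrakk> \<Longrightarrow> M u d = 0"
    and u: "u \<in> I - D" and d: "d \<in> D"
  shows "N u d = 0"
proof -
  have "finite D"
    using \<open>finite I\<close> \<open>D \<subseteq> I\<close> by (rule rev_finite_subset)
  have block: "(\<Sum>k\<in>D. N i k * M k j) = (if i = j then 1 else 0)" if "i \<in> I" "j \<in> D" for i j
  proof -
    have "(\<Sum>k\<in>D. N i k * M k j) = (\<Sum>k\<in>I. N i k * M k j)"
      using that \<open>finite I\<close> \<open>D \<subseteq> I\<close> zero by (intro sum.mono_neutral_left) auto
    then show ?thesis
      using that \<open>D \<subseteq> I\<close> left by auto
  qed
  have right: "(\<Sum>k\<in>D. M j k * N k d) = (if j = d then 1 else 0)" if "j \<in> D" for j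
  proof (rule left_inverse_imp_right_inverse_on[OF \<open>finite D\<close> _ that d])
    show "(\<Sum>k\<in>D. N i k * M k j) = (if i = j then 1 else 0)" if "i \<in> D" "j \<in> D" for i j
      using that \<open>D \<subseteq> I\<close> by (intro block) auto
  qed
  have "N u d = (\<Sum>j\<in>D. N u j * (\<Sum>k\<in>D. M j k * N k d))"
    using \<open>finite D\<close> d by (simp add: right if_distrib[of "\<lambda>t. _ * t"] cong: if_cong)
  also have "\<dots> = (\<Sum>k\<in>D. (\<Sum>j\<in>D. N u j * M j k) * N k d)"
    unfolding sum_distrib_left sum_distrib_right mult.assoc by (rule sum.swap)
  also have "\<dots> = 0"
    using u by (intro sum.neutral) (auto simp: block)
  finally show ?thesis .
qed

context finite_category
begin

lemma zeta_eq_0_iff: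
  assumes "a \<in> Ob A" "b \<in> Ob A"
  shows "zeta A (a, b) = 0 \<longleftrightarrow> Hom A a b = {}"
proof -
  have "finite (Hom A a b)"
    using finite_Arr by (simp add: Hom_def)
  then show ?thesis
    using assms by (simp add: zeta_def)
qed

lemma zeta_refl:
  assumes "a \<in> Ob A"
  shows "zeta A (a, a) \<noteq> 0"
  using assms Ident_in_Hom[OF assms] by (auto simp: zeta_eq_0_iff)

lemma zeta_trans:
  assumes "a \<in> Ob A" "b \<in> Ob A" "c \<in> Ob A" "zeta A (a, b) \<noteq> 0" "zeta A (b, c) \<noteq> 0"
  shows "zeta A (a, c) \<noteq> 0"
proof -
  obtain f g where "f \<in> Hom A a b" "g \<in> Hom A b c"
    using assms by (auto simp: zeta_eq_0_iff)
  then have "Comp A g f \<in> Hom A a c"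
    by (rule Comp_in_Hom)
  then show ?thesis
    using assms by (auto simp: zeta_eq_0_iff)
qed

lemma moebius_zeta:
  assumes "has_moebius_inversion A" "a \<in> Ob A" "c \<in> Ob A"
  shows "(\<Sum>b\<in>Ob A. moebius A (a, b) * zeta A (b, c)) = (if a = c then 1 else 0)"
proof -
  interpret R: ring "incidence_algebra A"
    by (rule incidence_algebra_ring)
  have "moebius A \<otimes>\<^bsub>incidence_algebra A\<^esub> zeta A = \<one>\<^bsub>incidence_algebra A\<^esub>"
    using assms(1) by (simp add: moebius_def has_moebius_inversion_def)
  from fun_cong[OF this, of "(a, c)"] show ?thesis
    using assms(2,3) by (simp add: incidence_algebra_def)
qed

end

theorem theorem4p1:
  fixes A :: "('o, 'm) category"
  assumes "finite_category A"
    and "has_moebius_inversion A"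
  shows "\<forall>a\<in>Ob A. \<forall>b\<in>Ob A. zeta A (a, b) = 0 \<longrightarrow> moebius A (a, b) = 0"
proof (intro ballI impI)
  interpret finite_category A by fact
  fix a b assume ab: "a \<in> Ob A" "b \<in> Ob A" "zeta A (a, b) = 0"
  define D where "D = {x \<in> Ob A. zeta A (x, b) \<noteq> 0}"
  show "moebius A (a, b) = 0"
  proof (rule left_inverse_block_triangular[of "Ob A" D "\<lambda>x y. moebius A (x, y)"
        "\<lambda>x y. zeta A (x, y)"])
    show "zeta A (u, d) = 0" if "u \<in> Ob A - D" "d \<in> D" for u d
      using that ab zeta_trans[of u d b] by (auto simp: D_def)
    show "b \<in> D"
      using ab zeta_refl by (simp add: D_def)
    show "a \<in> Ob A - D"
      using ab by (simp add: D_def)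
    show "D \<subseteq> Ob A"
      by (auto simp: D_def)
  qed (use finite_Ob moebius_zeta[OF assms(2)] in simp_all)
qed

end
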